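(* Let $f:\mathbb{R}^n\to\mathbb{R}$ be an invex function with minimum value $f^*$ (i.e. $f$ attains its minimum, $f^*=\min_{x\in\mathbb{R}^n} f(x)$). Assume further that $f$ is continuously differentiable and that $f$ is increasing at infinity. Then for every $c\in\mathbb{R}$ the sublevel set $L^-_c=\{x\in\mathbb{R}^n : f(x)\le c\}$ is connected. In particular, the set of minima $\{x\in\mathbb{R}^n : f(x)=f^*\}$ is connected.
   Context: A differentiable function $f:\mathbb{R}^n\to\mathbb{R}$ is called invex if every stationary point of $f$ (point with $\nabla f(x)=0$) is a global minimum of $f$; equivalently, there is $\eta:\mathbb{R}^n\times\mathbb{R}^n\to\mathbb{R}^n$ with $f(y)\ge f(x)+\nabla f(x)^T\eta(x,y)$ for all $x,y$. A function $f:\mathbb{R}^n\to\mathbb{R}$ is increasing at infinity if for every $x\in\mathbb{R}^n$ there exists a compact set $K\subset\mathbb{R}^n$ such that $f(z)>f(x)$ for all $z\in\mathbb{R}^n\setminus K$. The empty set is regarded as connected. *)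

theory Defs
  imports "HOL-Analysis.Analysis"
begin

definition gradient :: "(real ^ 'n \<Rightarrow> real) \<Rightarrow> real ^ 'n \<Rightarrow> real ^ 'n" where
  "gradient f x = (THE D. GDERIV f x :> D)"

(* Where f is not differentiable, gradient is unspecified; every use below is guarded by
   differentiability. *)
lemma GDERIV_gradient:
  fixes f :: "real ^ 'n \<Rightarrow> real"
  assumes "f differentiable (at x)"
  shows "GDERIV f x :> gradient f x"
proof -
  obtain f' where f': "(f has_derivative f') (at x)"
    using assms by (auto simp: differentiable_def)
  then have lin: "linear f'"
    by (rule has_derivative_linear)
  have "f' = (\<lambda>h. h \<bullet> adjoint f' 1)"
    using adjoint_works[OF lin, of _ 1] by (auto simp: fun_eq_iff)
  then have ex: "GDERIV f x :> adjoint f' 1"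
    using f' by (simp add: gderiv_def)
  have uniq: "D = D'" if "GDERIV f x :> D" "GDERIV f x :> D'" for D D'
  proof -
    have "(\<lambda>h. h \<bullet> D) = (\<lambda>h. h \<bullet> D')"
      using that unfolding gderiv_def by (rule has_derivative_unique)
    then show ?thesis
      by (metis vector_eq_ldot)
  qed
  show ?thesis
    unfolding gradient_def using ex uniq by (rule theI2) (use ex uniq in auto)
qed

definition invex :: "(real ^ 'n \<Rightarrow> real) \<Rightarrow> bool" where
  "invex f \<longleftrightarrow> f differentiable_on UNIV \<and> (\<forall>x. gradient f x = 0 \<longrightarrow> (\<forall>y. f x \<le> f y))"

lemma invex_iff_eta:
  fixes f :: "real ^ 'n \<Rightarrow> real"
  shows "invex f \<longleftrightarrow> f differentiable_on UNIV \<and>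
    (\<exists>\<eta> :: real ^ 'n \<Rightarrow> real ^ 'n \<Rightarrow> real ^ 'n. \<forall>x y. f y \<ge> f x + gradient f x \<bullet> \<eta> x y)"
proof -
  have "\<exists>\<eta>. \<forall>x y. f y \<ge> f x + gradient f x \<bullet> \<eta> x y"
    if st: "\<forall>x. gradient f x = 0 \<longrightarrow> (\<forall>y. f x \<le> f y)"
  proof (intro exI allI)
    fix x y
    show "f y \<ge> f x + gradient f x \<bullet>
        (((f y - f x) / (gradient f x \<bullet> gradient f x)) *\<^sub>R gradient f x)"
      using st by (cases "gradient f x = 0") auto
  qed
  moreover have "\<forall>x. gradient f x = 0 \<longrightarrow> (\<forall>y. f x \<le> f y)"
    if "\<exists>\<eta>. \<forall>x y. f y \<ge> f x + gradient f x \<bullet> \<eta> x y"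
    using that by (metis add.right_neutral inner_zero_left)
  ultimately show ?thesis
    unfolding invex_def by blast
qed

definition continuously_differentiable :: "(real ^ 'n \<Rightarrow> real) \<Rightarrow> bool" where
  "continuously_differentiable f \<longleftrightarrow> f differentiable_on UNIV \<and> continuous_on UNIV (gradient f)"

definition increasing_at_infinity :: "(real ^ 'n \<Rightarrow> real) \<Rightarrow> bool" where
  "increasing_at_infinity f \<longleftrightarrow> (\<forall>x. \<exists>K. compact K \<and> (\<forall>z. z \<notin> K \<longrightarrow> f z > f x))"

end

theory Submission
  imports Defs
begin

text \<open>
  A gradient step \<open>x - t \<nabla>f(x)\<close> fixes the minimizers and, for small \<open>t\<close>, pushes a
  compact part of a sublevel set strictly below its level whenever that level contains no stationary
  point. Hence the least level at which two minimizers can be joined by a continuum, which is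
  attained by intersecting nested continua, must be the minimum itself. So the set of minimizers is
  connected. A separation of any other compact sublevel set would separate it, since each
  of the two pieces contains a local and hence a global minimizer.
\<close>

text \<open>Compactness makes one step length work for all of \<open>C\<close>: otherwise failing
  points with step lengths tending to 0 accumulate at a point of level \<open>d\<close>, and the
  mean value theorem forces its gradient to vanish.\<close>

lemma gradient_step_below_level:
  fixes f :: "'a::euclidean_space \<Rightarrow> real"
  assumes f: "\<And>x. GDERIV f x :> g x"
    and g: "continuous_on UNIV g"
    and C: "compact C" "\<And>x. x \<in> C \<Longrightarrow> f x \<le> d"
    and nonstationary: "\<And>x. x \<in> C \<Longrightarrow> f x = d \<Longrightarrow> g x \<noteq> 0"
  shows "\<exists>t>0. \<forall>x\<in>C. f (x - t *\<^sub>R g x) < d"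
proof (rule ccontr)
  assume "\<not> ?thesis"
  then have "\<forall>n. \<exists>x\<in>C. d \<le> f (x - inverse (real (Suc n)) *\<^sub>R g x)"
    by (metis inverse_positive_iff_positive not_le of_nat_0_less_iff zero_less_Suc)
  then obtain y where y: "\<And>n. y n \<in> C"
    and yd: "\<And>n. d \<le> f (y n - inverse (real (Suc n)) *\<^sub>R g (y n))"
    by metis
  obtain x r where x: "x \<in> C" and r: "strict_mono r" and "(y \<circ> r) \<longlonglongrightarrow> x"
    using C(1) y unfolding compact_def by metis
  then have yr: "(\<lambda>n. y (r n)) \<longlonglongrightarrow> x"
    by (simp add: o_def)
  define s where "s n = inverse (real (Suc (r n)))" for n
  have s0: "s n > 0" for n
    by (simp add: s_def)
  have s: "s \<longlonglongrightarrow> 0"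
    using LIMSEQ_subseq_LIMSEQ[OF LIMSEQ_inverse_real_of_nat r] unfolding s_def o_def .
  have deriv: "(f has_derivative (\<lambda>h. h \<bullet> g z)) (at z)" for z
    using f[of z] by (simp add: gderiv_def)
  have gl: "(\<lambda>n. g (u n)) \<longlonglongrightarrow> g x" if "u \<longlonglongrightarrow> x" for u :: "nat \<Rightarrow> 'a"
    using continuous_on_tendsto_compose[OF g that] by simp
  have "(\<lambda>n. y (r n) - s n *\<^sub>R g (y (r n))) \<longlonglongrightarrow> x - 0 *\<^sub>R g x"
    by (intro tendsto_intros yr s gl)
  then have "(\<lambda>n. f (y (r n) - s n *\<^sub>R g (y (r n)))) \<longlonglongrightarrow> f x"
    using isCont_tendsto_compose[OF has_derivative_continuous[OF deriv, of x]] by simp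
  \<comment> \<open>The limit point lies exactly on level \<open>d\<close>, the only level where
    \<open>nonstationary\<close> applies.\<close>
  then have "d \<le> f x"
    by (rule LIMSEQ_le_const) (use yd s_def in auto)
  with x C(2) nonstationary have gx: "g x \<noteq> 0"
    by (meson order_antisym)
  \<comment> \<open>The step starts at a value at most \<open>d\<close> and ends at a value at least
    \<open>d\<close>. So somewhere along it the derivative in the direction of minus the gradient at
    the start is nonnegative.\<close>
  have "\<exists>\<xi>. 0 < \<xi> \<and> \<xi> < s n \<and> g (y (r n)) \<bullet> g (y (r n) - \<xi> *\<^sub>R g (y (r n))) \<le> 0" for n
  proof -
    let ?y = "y (r n)"
    have "((\<lambda>t. f (?y - t *\<^sub>R g ?y)) has_derivative
        (\<lambda>h. (- h *\<^sub>R g ?y) \<bullet> g (?y - t *\<^sub>R g ?y))) (at t)" for t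
      by (rule has_derivative_compose[OF _ deriv, of "\<lambda>t. ?y - t *\<^sub>R g ?y"])
        (auto intro!: derivative_eq_intros)
    then have "\<exists>\<xi>\<in>{0<..<s n}. f (?y - s n *\<^sub>R g ?y) - f (?y - 0 *\<^sub>R g ?y)
        = (- (s n - 0) *\<^sub>R g ?y) \<bullet> g (?y - \<xi> *\<^sub>R g ?y)"
      by (intro mvt_simple[OF s0]) (auto intro: has_derivative_at_withinI)
    then obtain \<xi> where \<xi>: "0 < \<xi>" "\<xi> < s n"
      "f (?y - s n *\<^sub>R g ?y) - f ?y = - (s n * (g ?y \<bullet> g (?y - \<xi> *\<^sub>R g ?y)))"
      by auto
    moreover have "f ?y \<le> f (?y - s n *\<^sub>R g ?y)"
      using yd[of "r n"] C(2)[OF y[of "r n"]] by (simp add: s_def)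
    ultimately have "s n * (g ?y \<bullet> g (?y - \<xi> *\<^sub>R g ?y)) \<le> 0"
      by linarith
    with \<xi> s0[of n] show ?thesis
      by (auto simp: mult_le_0_iff)
  qed
  then obtain \<xi> where \<xi>0: "\<And>n. 0 < \<xi> n" and \<xi>s: "\<And>n. \<xi> n < s n"
    and le: "\<And>n. g (y (r n)) \<bullet> g (y (r n) - \<xi> n *\<^sub>R g (y (r n))) \<le> 0"
    by metis
  have "\<xi> \<longlonglongrightarrow> 0"
    by (rule tendsto_sandwich[OF _ _ tendsto_const s])
      (auto intro!: always_eventually less_imp_le \<xi>0 \<xi>s)
  then have "(\<lambda>n. y (r n) - \<xi> n *\<^sub>R g (y (r n))) \<longlonglongrightarrow> x - 0 *\<^sub>R g x"
    by (intro tendsto_intros yr gl)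
  then have "(\<lambda>n. g (y (r n)) \<bullet> g (y (r n) - \<xi> n *\<^sub>R g (y (r n)))) \<longlonglongrightarrow> g x \<bullet> g x"
    by (intro tendsto_inner gl yr) simp
  then have "g x \<bullet> g x \<le> 0"
    by (rule LIMSEQ_le_const2) (use le in auto)
  with gx show False
    by (metis inner_gt_zero_iff not_le)
qed

lemma local_min_imp_GDERIV_zero:
  assumes "GDERIV f x :> D" "open S" "x \<in> S" "\<And>y. y \<in> S \<Longrightarrow> f x \<le> f y"
  shows "D = 0"
proof -
  have "(\<lambda>h. h \<bullet> D) = (\<lambda>h. 0)"
    using assms differential_zero_maxmin[of x S f] unfolding gderiv_def by auto
  then show ?thesis
    by (metis inner_eq_zero_iff)
qed

lemma connected_minimizers:
  fixes f :: "'a::euclidean_space \<Rightarrow> real"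
  assumes f: "\<And>x. GDERIV f x :> g x"
    and g: "continuous_on UNIV g"
    and stationary: "\<And>x. g x = 0 \<Longrightarrow> f x = m"
    and m: "\<And>x. m \<le> f x"
    and comp: "\<And>z. compact {x. f x \<le> f z}"
  shows "connected {x. f x = m}"
  unfolding connected_iff_connected_component
proof (intro ballI)
  fix a b
  assume "a \<in> {x. f x = m}" "b \<in> {x. f x = m}"
  then have fa: "f a = m" and fb: "f b = m"
    by auto
  have contf: "continuous_on S f" for S
    using f by (auto simp: gderiv_def intro!: has_derivative_continuous continuous_at_imp_continuous_on)
  \<comment> \<open>Minimizers are stationary, so the gradient step will fix \<open>a\<close> and
    \<open>b\<close>.\<close>
  have stat0: "g x = 0" if "f x = m" for x
    using local_min_imp_GDERIV_zero[OF f, of UNIV x] that m by simp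
  \<comment> \<open>The segment joins \<open>a\<close> to \<open>b\<close>, so its maximal value
    \<open>f w\<close> is a first level at which they are connected.\<close>
  obtain w where w: "\<And>x. x \<in> closed_segment a b \<Longrightarrow> f x \<le> f w"
    using continuous_attains_sup[OF compact_segment _ contf, of a b] by auto
  let ?S = "\<lambda>d. connected_component_set {x. f x \<le> d} a"
  \<comment> \<open>The bound by the attained value \<open>f w\<close> makes \<open>comp\<close>
    applicable. As \<open>f\<close> may be bounded above, sublevel sets of higher levels could be
    the whole space.\<close>
  define D where "D = {d. d \<le> f w \<and> b \<in> ?S d}"
  have wD: "f w \<in> D"
    using w by (auto simp: D_def connected_component_def intro!: exI[of _ "closed_segment a b"])
  have Dm: "m \<le> d" if "d \<in> D" for d
    using that connected_component_in[of "{x. f x \<le> d}" a b] fa by (auto simp: D_def)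
  have bdd: "bdd_below D"
    using Dm by (meson bdd_belowI)
  have mono: "?S d \<subseteq> ?S e" if "d \<le> e" for d e
    using that by (intro connected_component_mono) auto
  have closed: "closed {x. f x \<le> d}" for d
    by (intro closed_Collect_le contf continuous_intros)
  have compS: "compact (?S d)" if "d \<in> D" for d
  proof -
    have "{x. f x \<le> d} = {x. f x \<le> f w} \<inter> {x. f x \<le> d}"
      using that by (auto simp: D_def)
    then have "compact {x. f x \<le> d}"
      by (metis comp closed compact_Int_closed)
    then show ?thesis
      using compact_components componentsI connected_component_eq_empty compact_empty by metis
  qed
  define T where "T = \<Inter>(?S ` D)"
  \<comment> \<open>The components grow with the level, so they form a chain of compact connected
    sets, whose intersection is connected.\<close>
  have "connected T"
    unfolding T_def
  proof (rule connected_chain)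
    show "S \<subseteq> T \<or> T \<subseteq> S" if ST: "S \<in> ?S ` D \<and> T \<in> ?S ` D" for S T
    proof -
      obtain d e where "S = ?S d" "T = ?S e"
        using ST by blast
      then show ?thesis
        using mono linear[of d e] by metis
    qed
  qed (use compS in auto)
  have "compact T"
    unfolding T_def using compS wD by (intro compact_Inter) auto
  have aT: "a \<in> T" and bT: "b \<in> T"
    using Dm fa by (auto simp: T_def D_def)
  \<comment> \<open>The infimum is attained: the connected set \<open>T\<close> contains
    \<open>a\<close> and \<open>b\<close> and lies in the sublevel set of \<open>d\<close>.\<close>
  define d where "d = Inf D"
  have Td: "f x \<le> d" if "x \<in> T" for x
    unfolding d_def
  proof (rule cInf_greatest)
    show "f x \<le> e" if "e \<in> D" for e
      using \<open>x \<in> T\<close> that connected_component_in[of "{x. f x \<le> e}" a x] by (auto simp: T_def)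
  qed (use wD in auto)
  have "d \<le> m"
  proof (rule ccontr)
    assume "\<not> d \<le> m"
    then have "g x \<noteq> 0" if "f x = d" for x
      using stationary that by force
    then obtain t where t: "t > 0" "\<And>x. x \<in> T \<Longrightarrow> f (x - t *\<^sub>R g x) < d"
      using gradient_step_below_level[OF f g \<open>compact T\<close> Td] by metis
    define \<Phi> where "\<Phi> x = x - t *\<^sub>R g x" for x
    have cont\<Phi>: "continuous_on T \<Phi>"
      unfolding \<Phi>_def by (intro continuous_intros continuous_on_subset[OF g]) auto
    have "a \<in> \<Phi> ` T" "b \<in> \<Phi> ` T"
      using aT bT fa fb stat0 by (force simp: \<Phi>_def image_iff)+
    moreover obtain z where z: "z \<in> T" "\<And>x. x \<in> T \<Longrightarrow> f (\<Phi> x) \<le> f (\<Phi> z)"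
      using continuous_attains_sup[OF \<open>compact T\<close> _ continuous_on_compose2[OF contf cont\<Phi>]] aT
      by blast
    \<comment> \<open>The image of \<open>T\<close> under \<open>\<Phi>\<close> is connected,
      contains the fixed points \<open>a\<close> and \<open>b\<close>, and has maximal value
      \<open>f (\<Phi> z)\<close>. This level is below \<open>d\<close> and yet joins
      \<open>a\<close> to \<open>b\<close>.\<close>
    ultimately have "b \<in> ?S (f (\<Phi> z))"
      using connected_continuous_image[OF cont\<Phi> \<open>connected T\<close>]
      by (auto simp: connected_component_def intro!: exI[of _ "\<Phi> ` T"])
    moreover have "f (\<Phi> z) < d"
      using t z by (simp add: \<Phi>_def)
    moreover have "d \<le> f w"
      unfolding d_def using wD bdd by (rule cInf_lower)
    ultimately have "f (\<Phi> z) \<in> D"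
      by (simp add: D_def)
    then show False
      using cInf_lower[OF _ bdd] \<open>f (\<Phi> z) < d\<close> unfolding d_def by force
  qed
  then have "T \<subseteq> {x. f x = m}"
    using Td m by (fastforce intro: order_antisym)
  then show "connected_component {x. f x = m} a b"
    unfolding connected_component_def using aT bT \<open>connected T\<close> by blast
qed

lemma connected_sublevel_set:
  fixes f :: "'a::euclidean_space \<Rightarrow> real"
  assumes f: "\<And>x. GDERIV f x :> g x"
    and stationary: "\<And>x. g x = 0 \<Longrightarrow> f x = m"
    and conn: "connected {x. f x = m}"
    and comp: "compact {x. f x \<le> c}"
  shows "connected {x. f x \<le> c}"
proof (rule ccontr)
  let ?L = "{x. f x \<le> c}"
  assume "\<not> connected ?L"
  then obtain A B where A: "closed A" and B: "closed B" and AB: "A \<inter> B = {}" "A \<union> B = ?L"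
    and ne: "A \<noteq> {}" "B \<noteq> {}"
    using comp compact_imp_closed connected_closed_set by metis
  have contf: "continuous_on S f" for S
    using f by (auto simp: gderiv_def intro!: has_derivative_continuous continuous_at_imp_continuous_on)
  have meets: "\<exists>p\<in>P. f p = m"
    if P: "closed P" and Q: "closed Q" and PQ: "P \<inter> Q = {}" "P \<union> Q = ?L" "P \<noteq> {}" for P Q
  proof -
    have "compact P"
      using comp P PQ by (metis Un_upper1 compact_Int_closed inf.absorb2)
    then obtain p where p: "p \<in> P" "\<And>x. x \<in> P \<Longrightarrow> f p \<le> f x"
      using continuous_attains_inf contf PQ by metis
    \<comment> \<open>The open set \<open>- Q\<close> is a neighbourhood of \<open>p\<close>
      consisting of \<open>P\<close>, where \<open>p\<close> is minimal, and of points outside the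
      sublevel set, where \<open>f\<close> exceeds \<open>c\<close>. So \<open>p\<close> is a local
      minimizer.\<close>
    have "f p \<le> f x" if "x \<in> - Q" for x
    proof (cases "x \<in> P")
      case False
      with that PQ(2) have "c < f x"
        by (metis (mono_tags) ComplD UnE mem_Collect_eq not_le)
      moreover have "f p \<le> c"
        using p(1) PQ(2) by auto
      ultimately show ?thesis
        by simp
    qed (use p in auto)
    then have "g p = 0"
      using local_min_imp_GDERIV_zero[OF f, of "- Q" p] Q p PQ by auto
    with stationary p show ?thesis
      by blast
  qed
  have "\<exists>p\<in>A. f p = m" "\<exists>p\<in>B. f p = m"
    using meets[OF A B] meets[OF B A] AB ne by (auto simp: Int_commute Un_commute)
  \<comment> \<open>A point of value \<open>m\<close> in \<open>A\<close> shows
    \<open>m \<le> c\<close>, so the whole level set of \<open>m\<close> lies in the sublevel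
    set.\<close>
  moreover from this have "{x. f x = m} \<subseteq> A \<union> B"
    using AB by auto
  ultimately show False
    using connected_closedD[OF conn, of A B] A B AB by blast
qed

theorem theorem2:
  fixes f :: "real ^ 'n \<Rightarrow> real" and fstar :: real
  assumes "invex f"
    and "\<exists>x. f x = fstar" and "\<forall>x. fstar \<le> f x"
    and "continuously_differentiable f"
    and "increasing_at_infinity f"
  shows "(\<forall>c :: real. connected {x. f x \<le> c}) \<and> connected {x. f x = fstar}"
proof -
  have diff: "f differentiable (at x)" for x
    using assms(1) by (auto simp: invex_def differentiable_on_def)
  note grad = GDERIV_gradient[OF diff]
  have cont: "continuous_on UNIV (gradient f)"
    using assms(4) by (simp add: continuously_differentiable_def)
  have stationary: "f x = fstar" if "gradient f x = 0" for x
    using assms(1-3) that unfolding invex_def by (metis order_antisym)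
  \<comment> \<open>Outside \<open>K\<close> the values exceed \<open>f z\<close>, hence
    \<open>c\<close>, so the sublevel set is a closed part of \<open>K\<close>.\<close>
  have comp: "compact {x. f x \<le> c}" if "c \<le> f z" for c z
  proof -
    obtain K where K: "compact K" "\<And>x. x \<notin> K \<Longrightarrow> f z < f x"
      using assms(5) unfolding increasing_at_infinity_def by metis
    have "continuous_on UNIV f"
      using diff by (auto intro!: differentiable_imp_continuous_within continuous_at_imp_continuous_on)
    then have "closed {x. f x \<le> c}"
      by (intro closed_Collect_le continuous_intros)
    moreover have "{x. f x \<le> c} = K \<inter> {x. f x \<le> c}"
      using K(2) that by force
    ultimately show ?thesis
      using K(1) by (metis compact_Int_closed)
  qed
  have conn: "connected {x. f x = fstar}"
    using assms(3) by (intro connected_minimizers[OF grad cont stationary] comp) auto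
  \<comment> \<open>A level above every value of \<open>f\<close> gives the whole space, which is
    connected but not compact, so it is treated separately.\<close>
  have "connected {x. f x \<le> c}" for c
  proof (cases "\<exists>z. c \<le> f z")
    case True
    then show ?thesis
      using connected_sublevel_set[OF grad stationary conn] comp by blast
  next
    case False
    then have "{x. f x \<le> c} = UNIV"
      by (auto intro: less_imp_le simp: not_le)
    then show ?thesis
      by (metis connected_UNIV)
  qed
  with conn show ?thesis
    by blast
qed

end
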